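(* Let $n\ge2$ and let $X_1,\ldots,X_n$ be independent, identically distributed, nonnegative absolutely continuous random variables with common distribution function $F$ and density $f$, and let $X_{1:n}$ and $X_{n:n}$ denote their minimum and maximum. Let $0<p<q<1$ and let $\xi_p=F^{-1}(p)$, $\xi_q=F^{-1}(q)$, where $F^{-1}$ is the generalized inverse of $F$. Then the dynamic mutual information of $[(X_{1:n},X_{n:n})\,|\,X_{1:n}\le \xi_p,\ X_{n:n}>\xi_q]$ is given by $$\begin{aligned} M^*_{1,n:n}(\xi_p,\xi_q)={}&\log\Big[\frac{n-1}{n}H_n(p,q)\Big]-\frac{(n-2)(2n-1)}{n(n-1)}\\ &-\frac{n}{H_n(p,q)}\Big\{K_n(p,q)+K_n(1-q,1-p)\\ &\qquad+\frac{n-2}{n}\big[(1-p)^n\log(1-p)+q^n\log q-(q-p)^n\log(q-p)\big]\Big\},\end{aligned}$$ where $$H_n(p,q)=1-q^n+(q-p)^n-(1-p)^n,$$ $$K_n(p,q)=\int_0^p\big[(1-u)^{n-1}-(q-u)^{n-1}\big]\log\big((1-u)^{n-1}-(q-u)^{n-1}\big)\,{\rm d}u.$$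
   Context: $\log$ is the natural logarithm. $[Z\,|\,B]$ denotes a random vector distributed as $Z$ conditional on $B$. For $0<s<t$ such that $\mathbb P(X_{1:n}\le s,X_{n:n}>t)>0$, the dynamic mutual information of $[(X_{1:n},X_{n:n})\,|\,X_{1:n}\le s,X_{n:n}>t]$ is $$M^*_{1,n:n}(s,t)=\int_0^s{\rm d}x\int_t^{+\infty} f^*_{1,n:n}(x,y;s,t)\,\log\frac{f^*_{1,n:n}(x,y;s,t)}{f^*_{1:n}(x;s,t)\,f^*_{n:n}(y;s,t)}\,{\rm d}y,$$ where $f^*_{1,n:n}(x,y;s,t)$ (for $0<x<s<t<y$) is the joint density of $[(X_{1:n},X_{n:n})\,|\,X_{1:n}\le s,X_{n:n}>t]$, and $f^*_{1:n}(x;s,t)$, $f^*_{n:n}(y;s,t)$ are the marginal densities of $[X_{1:n}\,|\,X_{1:n}\le s,X_{n:n}>t]$ and $[X_{n:n}\,|\,X_{1:n}\le s,X_{n:n}>t]$. The integrand is $0$ where the joint density is $0$. *)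

theory Defs
  imports "HOL-Probability.Probability"
begin

text \<open>A real-valued version of the density of the random vector \<open>Z\<close> with respect to Lebesgue
  measure. It is determined only almost everywhere; see \<open>rv_density_eq_AE\<close>.\<close>

definition rv_density :: "'a measure \<Rightarrow> ('a \<Rightarrow> 'b::euclidean_space) \<Rightarrow> 'b \<Rightarrow> real" where
  "rv_density M Z x = enn2real (RN_deriv lborel (distr M lborel Z) x)"

lemma rv_density_eq_AE:
  assumes "distributed M lborel Z (\<lambda>x. ennreal (g x))" and "\<And>x. 0 \<le> g x"
  shows "AE x in lborel. rv_density M Z x = g x"
proof -
  have "AE x in lborel. ennreal (g x) = RN_deriv lborel (distr M lborel Z) x"
    using assms(1) by (intro sigma_finite_measure.RN_deriv_unique[OF sigma_finite_lborel])
      (auto simp: distributed_def)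
  then show ?thesis
    by eventually_elim (metis rv_density_def assms(2) enn2real_ennreal)
qed

text \<open>\<open>uniform_measure M B\<close> is the conditional probability given \<open>B\<close>, so random vectors on
  \<open>tail_cond M Y Z s t\<close> have the law that they have on \<open>M\<close> conditional on \<open>Y \<le> s, Z > t\<close>.\<close>

definition tail_cond ::
    "'a measure \<Rightarrow> ('a \<Rightarrow> real) \<Rightarrow> ('a \<Rightarrow> real) \<Rightarrow> real \<Rightarrow> real \<Rightarrow> 'a measure" where
  "tail_cond M Y Z s t = uniform_measure M {\<omega> \<in> space M. Y \<omega> \<le> s \<and> Z \<omega> > t}"

text \<open>Where the joint density vanishes, the integrand is \<open>0\<close> whatever the value of \<open>ln\<close>.\<close>

definition dyn_mi_integrand ::
    "'a measure \<Rightarrow> ('a \<Rightarrow> real) \<Rightarrow> ('a \<Rightarrow> real) \<Rightarrow> real \<Rightarrow> real \<Rightarrow> real \<Rightarrow> real \<Rightarrow> real" where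
  "dyn_mi_integrand M Y Z s t x y =
     (let C = tail_cond M Y Z s t;
          fYZ = rv_density C (\<lambda>\<omega>. (Y \<omega>, Z \<omega>));
          fY = rv_density C Y;
          fZ = rv_density C Z
      in fYZ (x, y) * ln (fYZ (x, y) / (fY x * fZ y)))"

definition dyn_mutual_information ::
    "'a measure \<Rightarrow> ('a \<Rightarrow> real) \<Rightarrow> ('a \<Rightarrow> real) \<Rightarrow> real \<Rightarrow> real \<Rightarrow> real" where
  "dyn_mutual_information M Y Z s t =
     (LBINT x:{0<..<s}. (LBINT y:{t<..}. dyn_mi_integrand M Y Z s t x y))"

definition generalized_inverse :: "(real \<Rightarrow> real) \<Rightarrow> real \<Rightarrow> real" where
  "generalized_inverse F u = Inf {x. u \<le> F x}"

definition sample_min :: "(nat \<Rightarrow> 'a \<Rightarrow> real) \<Rightarrow> nat \<Rightarrow> 'a \<Rightarrow> real" where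
  "sample_min X n \<omega> = (MIN i\<in>{1..n}. X i \<omega>)"

definition sample_max :: "(nat \<Rightarrow> 'a \<Rightarrow> real) \<Rightarrow> nat \<Rightarrow> 'a \<Rightarrow> real" where
  "sample_max X n \<omega> = (MAX i\<in>{1..n}. X i \<omega>)"

definition H :: "nat \<Rightarrow> real \<Rightarrow> real \<Rightarrow> real" where
  "H n p q = 1 - q ^ n + (q - p) ^ n - (1 - p) ^ n"

definition K :: "nat \<Rightarrow> real \<Rightarrow> real \<Rightarrow> real" where
  "K n p q = (LBINT u:{0..p}. ((1 - u) ^ (n - 1) - (q - u) ^ (n - 1)) *
                               ln ((1 - u) ^ (n - 1) - (q - u) ^ (n - 1)))"

end

theory Submission
  imports Defs
begin

text \<open>The probability integral transform reduces everything to the uniform distribution. If \<open>F\<close> is the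
  continuous distribution function, then \<open>F (X i)\<close> is uniform on \<open>[0, 1]\<close>, and \<open>X i \<le> \<xi>\<^sub>p\<close> holds
  exactly when \<open>F (X i) \<le> p\<close>, up to a null set. From
  \<open>P (min \<le> a, max > b) = 1 - F b ^ n + (F b - F a) ^ n - (1 - F a) ^ n\<close> the conditional joint density is
  \<open>f x * f y * c * (F y - F x) ^ (n - 2)\<close>; the factors \<open>f x\<close>, \<open>f y\<close> cancel inside the logarithm. What
  remains is the integral of a continuous function over the box \<open>[0, p] \<times> [q, 1]\<close>. The logarithm
  splits it into four terms: the two marginals give the \<open>K\<close>-integrals, and \<open>(v - u) ^ (n - 2) * ln (v - u)\<close>
  is integrated by taking two antiderivatives.\<close>

section \<open>Integrals over the box\<close>

lemma box_integrable:
  fixes h :: "real \<Rightarrow> real \<Rightarrow> real"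
  assumes "continuous_on ({a..b} \<times> {c..d}) (\<lambda>(u, v). h u v)"
  shows "integrable (lborel \<Otimes>\<^sub>M lborel) (\<lambda>(u, v). indicator {a..b} u * (indicator {c..d} v * h u v))"
proof -
  have "integrable lborel (\<lambda>z. indicator ({a..b} \<times> {c..d}) z *\<^sub>R (case z of (u, v) \<Rightarrow> h u v))"
    using assms by (intro borel_integrable_compact compact_Times) auto
  also have "(\<lambda>z. indicator ({a..b} \<times> {c..d}) z *\<^sub>R (case z of (u, v) \<Rightarrow> h u v)) =
      (\<lambda>(u, v). indicator {a..b} u * (indicator {c..d} v * h u v))"
    by (auto simp: fun_eq_iff indicator_times)
  finally show ?thesis by (simp add: lborel_prod)
qed

text \<open>Both orders of integration are provided because one logarithmic term of the integrand
  depends on \<open>u\<close> alone and another on \<open>v\<close> alone; in each case the other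
  variable is integrated first.\<close>

lemma box_integral:
  fixes h :: "real \<Rightarrow> real \<Rightarrow> real"
  assumes "continuous_on ({a..b} \<times> {c..d}) (\<lambda>(u, v). h u v)"
  shows "(\<integral>(u, v). indicator {a..b} u * (indicator {c..d} v * h u v) \<partial>(lborel \<Otimes>\<^sub>M lborel)) =
      (LBINT u:{a..b}. LBINT v:{c..d}. h u v)" (is ?fst)
    and "(\<integral>(u, v). indicator {a..b} u * (indicator {c..d} v * h u v) \<partial>(lborel \<Otimes>\<^sub>M lborel)) =
      (LBINT v:{c..d}. LBINT u:{a..b}. h u v)" (is ?snd)
proof -
  note int = box_integrable[OF assms]
  show ?fst
    unfolding lborel_pair.integral_fst[OF int, symmetric]
    by (simp add: set_lebesgue_integral_def)
  have "(\<lambda>u. indicator {a..b} u * (indicator {c..d} v * h u v)) =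
      (\<lambda>u. indicator {c..d} v * (indicator {a..b} u * h u v))" for v
    by (simp add: fun_eq_iff)
  then show ?snd
    unfolding lborel_pair.integral_snd[OF int, symmetric]
    by (simp add: set_lebesgue_integral_def)
qed

lemma set_integral_FTC:
  fixes g G :: "real \<Rightarrow> real"
  assumes "a \<le> b" "\<And>x. a \<le> x \<Longrightarrow> x \<le> b \<Longrightarrow> (G has_real_derivative g x) (at x)"
    and "continuous_on {a..b} g"
  shows "(LBINT x:{a..b}. g x) = G b - G a"
  unfolding set_lebesgue_integral_def
  using assms by (intro integral_FTC_atLeastAtMost)
    (auto simp: has_real_derivative_iff_has_vector_derivative[symmetric] intro: DERIV_subset)

section \<open>Powers of the gap \<open>v - u\<close>, with and without a logarithm\<close>

text \<open>The function \<open>(1 - u) ^ n - (q - u) ^ n\<close> is strictly decreasing on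
  \<open>[0, p]\<close>, and \<open>H n p q\<close> is its value at 0 minus its value at
  \<open>p\<close>.\<close>

lemma H_pos:
  assumes "2 \<le> n" "0 < p" "p < q" "q < 1"
  shows "0 < H n p q"
proof -
  have "(1 - p) ^ n - (q - p) ^ n < (1 - 0) ^ n - (q - 0) ^ n"
  proof (rule DERIV_neg_imp_decreasing[OF \<open>0 < p\<close>])
    fix u assume u: "0 \<le> u" "u \<le> p"
    have "((\<lambda>u. (1 - u) ^ n - (q - u) ^ n) has_real_derivative
        real n * ((q - u) ^ (n - 1) - (1 - u) ^ (n - 1))) (at u)"
      by (auto intro!: derivative_eq_intros simp: algebra_simps)
    moreover have "(q - u) ^ (n - 1) < (1 - u) ^ (n - 1)"
      using assms u by (intro power_strict_mono) auto
    then have "real n * ((q - u) ^ (n - 1) - (1 - u) ^ (n - 1)) < 0"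
      using assms by (intro mult_pos_neg) auto
    ultimately show "\<exists>y. ((\<lambda>u. (1 - u) ^ n - (q - u) ^ n) has_real_derivative y) (at u) \<and> y < 0"
      by blast
  qed
  then show ?thesis by (simp add: H_def)
qed

text \<open>Up to a constant, \<open>(v - u) ^ (n - 2)\<close> is the joint density of the minimum
  \<open>u\<close> and the maximum \<open>v\<close> of \<open>n\<close> uniform variables.
  Antiderivatives in either variable yield the two marginals.\<close>

lemma DERIV_power_gap:
  assumes "2 \<le> n"
  shows "((\<lambda>v. (v - u) ^ (n - 1) / (real n - 1)) has_real_derivative (v - u) ^ (n - 2)) (at v)"
    and "((\<lambda>u. - ((v - u) ^ (n - 1)) / (real n - 1)) has_real_derivative (v - u) ^ (n - 2)) (at u)"
proof -
  have "real (n - Suc 0) = real n - 1" "n - Suc (Suc 0) = n - 2" using assms by auto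
  then show "((\<lambda>v. (v - u) ^ (n - 1) / (real n - 1)) has_real_derivative (v - u) ^ (n - 2)) (at v)"
    "((\<lambda>u. - ((v - u) ^ (n - 1)) / (real n - 1)) has_real_derivative (v - u) ^ (n - 2)) (at u)"
    using assms by (auto intro!: derivative_eq_intros)
qed

text \<open>The second integration, after \<open>v\<close> has been integrated out: between 0 and
  \<open>a\<close> this antiderivative grows by \<open>H n a b / (n * (n - 1))\<close>, which is
  where the normalising constant comes from.\<close>

lemma DERIV_H:
  assumes "2 \<le> n"
  shows "((\<lambda>u. ((b - u) ^ n - (1 - u) ^ n) / (real n * (real n - 1))) has_real_derivative
      ((1 - u) ^ (n - 1) - (b - u) ^ (n - 1)) / (real n - 1)) (at u)"
  using assms by (auto intro!: derivative_eq_intros simp: divide_simps) (auto simp: algebra_simps)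

lemma nn_integral_power_gap_right:
  assumes "2 \<le> n" "u \<le> b" "b \<le> 1"
  shows "(\<integral>\<^sup>+v. ennreal ((v - u) ^ (n - 2)) * indicator {b..1} v \<partial>lborel) =
      ennreal (((1 - u) ^ (n - 1) - (b - u) ^ (n - 1)) / (real n - 1))"
  using assms
  by (subst nn_integral_FTC_Icc[OF _ DERIV_power_gap(1)]) (auto simp: diff_divide_distrib)

lemma nn_integral_power_gap_left:
  assumes "2 \<le> n" "0 \<le> a" "a \<le> v"
  shows "(\<integral>\<^sup>+u. ennreal ((v - u) ^ (n - 2)) * indicator {0..a} u \<partial>lborel) =
      ennreal ((v ^ (n - 1) - (v - a) ^ (n - 1)) / (real n - 1))"
  using assms
  by (subst nn_integral_FTC_Icc[OF _ DERIV_power_gap(2)]) (auto simp: diff_divide_distrib)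

lemma nn_integral_H:
  assumes "2 \<le> n" "0 \<le> a" "a \<le> b" "b \<le> 1"
  shows "(\<integral>\<^sup>+u. ennreal (((1 - u) ^ (n - 1) - (b - u) ^ (n - 1)) / (real n - 1)) * indicator {0..a} u \<partial>lborel) =
      ennreal (H n a b / (real n * (real n - 1)))"
proof -
  have "(b - u) ^ (n - 1) \<le> (1 - u) ^ (n - 1)" if "u \<le> a" for u
    using assms that by (intro power_mono) auto
  then have "(\<integral>\<^sup>+u. ennreal (((1 - u) ^ (n - 1) - (b - u) ^ (n - 1)) / (real n - 1)) * indicator {0..a} u \<partial>lborel) =
      ennreal (((b - a) ^ n - (1 - a) ^ n) / (real n * (real n - 1)) -
        ((b - 0) ^ n - (1 - 0) ^ n) / (real n * (real n - 1)))"
    using assms by (intro nn_integral_FTC_Icc DERIV_H) auto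
  then show ?thesis by (simp add: H_def diff_divide_distrib add_divide_distrib algebra_simps)
qed

text \<open>The reflection \<open>v = 1 - w\<close> exchanges minimum and maximum. It turns
  \<open>v ^ (n - 1) - (v - p) ^ (n - 1)\<close> into
  \<open>(1 - w) ^ (n - 1) - ((1 - p) - w) ^ (n - 1)\<close> and \<open>[q, 1]\<close> into
  \<open>[0, 1 - q]\<close>.\<close>

lemma set_integral_K:
  "(LBINT v:{q..1}. (v ^ (n - 1) - (v - p) ^ (n - 1)) * ln (v ^ (n - 1) - (v - p) ^ (n - 1))) =
    K n (1 - q) (1 - p)"
proof -
  define g where "g v = v ^ (n - 1) - (v - p) ^ (n - 1)" for v
  have "(LBINT v:{q..1}. g v * ln (g v)) =
      \<bar>- 1\<bar> *\<^sub>R (LBINT w. indicator {q..1} (1 + (- 1) * w) *\<^sub>R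
        (g (1 + (- 1) * w) * ln (g (1 + (- 1) * w))))"
    unfolding set_lebesgue_integral_def by (rule lborel_integral_real_affine) simp
  also have "\<dots> = (LBINT w:{0..1 - q}. g (1 - w) * ln (g (1 - w)))"
    unfolding set_lebesgue_integral_def
    by (auto intro!: Bochner_Integration.integral_cong split: split_indicator)
  finally show ?thesis
    by (simp add: K_def g_def algebra_simps)
qed

lemma integral_power_gap_ln:
  assumes n: "2 \<le> n" and pq: "0 < p" "p < q" "q < 1"
  shows "(LBINT u:{0..p}. LBINT v:{q..1}. (v - u) ^ (n - 2) * ln (v - u)) =
    ((q - p) ^ n * ln (q - p) - (1 - p) ^ n * ln (1 - p) - q ^ n * ln q) / (real n * (real n - 1))
      - (2 * real n - 1) * H n p q / (real n * (real n - 1)) ^ 2"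
proof -
  define N where "N = real n"
  have N: "N \<ge> 2" "real (n - Suc 0) = N - 1" "real n = N" using n by (auto simp: N_def)
  \<comment> \<open>\<open>\<beta>'' = \<alpha>' = x ^ (n - 2) * ln x\<close>\<close>
  define \<alpha> where "\<alpha> x = x ^ (n - 1) * ln x / (N - 1) - x ^ (n - 1) / (N - 1) ^ 2" for x
  define \<beta> where "\<beta> x = x ^ n * ln x / (N * (N - 1)) - (2 * N - 1) * x ^ n / (N * (N - 1)) ^ 2" for x
  have pw: "x ^ (n - 1) = x * x ^ (n - 2)" "x ^ n = x * x ^ (n - 1)" for x :: real
    using n by (simp_all add: power_eq_if numeral_2_eq_2)
  have d\<alpha>: "(\<alpha> has_real_derivative x ^ (n - 2) * ln x) (at x)" if "x > 0" for x
  proof -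
    have "(\<alpha> has_real_derivative ((N - 1) * x ^ (n - 2) * ln x + x ^ (n - 1) / x) / (N - 1)
        - (N - 1) * x ^ (n - 2) / (N - 1) ^ 2) (at x)"
      unfolding \<alpha>_def using that N
      by (auto intro!: derivative_eq_intros simp: numeral_2_eq_2)
    also have "((N - 1) * x ^ (n - 2) * ln x + x ^ (n - 1) / x) / (N - 1)
        - (N - 1) * x ^ (n - 2) / (N - 1) ^ 2 = x ^ (n - 2) * ln x"
      using that N unfolding pw(1) by (simp add: power2_eq_square divide_simps)
    finally show ?thesis .
  qed
  have d\<beta>: "(\<beta> has_real_derivative \<alpha> x) (at x)" if "x > 0" for x
  proof -
    have "(\<beta> has_real_derivative (N * x ^ (n - 1) * ln x + x ^ n / x) / (N * (N - 1))
        - (2 * N - 1) * (N * x ^ (n - 1)) / (N * (N - 1)) ^ 2) (at x)"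
      unfolding \<beta>_def using that N
      by (intro DERIV_diff DERIV_cdivide) (auto intro!: derivative_eq_intros)
    also have "(N * x ^ (n - 1) * ln x + x ^ n / x) / (N * (N - 1))
        - (2 * N - 1) * (N * x ^ (n - 1)) / (N * (N - 1)) ^ 2 = \<alpha> x"
      using that N unfolding \<alpha>_def by (simp add: pw(2) power2_eq_square divide_simps) (simp add: algebra_simps)
    finally show ?thesis .
  qed
  have c\<alpha>: "continuous_on S (\<lambda>x. \<alpha> (h x))" if "continuous_on S h" "\<And>x. x \<in> S \<Longrightarrow> h x > 0"
    for S :: "real set" and h
    using that N unfolding \<alpha>_def by (auto intro!: continuous_intros simp: less_le)
  \<comment> \<open>On the box \<open>v - u\<close> is at least \<open>q - p > 0\<close>, so the
    singularity of the logarithm is never met.\<close>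
  have "(LBINT u:{0..p}. LBINT v:{q..1}. (v - u) ^ (n - 2) * ln (v - u)) =
      (LBINT u:{0..p}. \<alpha> (1 - u) - \<alpha> (q - u))"
  proof (rule set_lebesgue_integral_cong, simp, intro allI impI)
    fix u assume "u \<in> {0..p}"
    then show "(LBINT v:{q..1}. (v - u) ^ (n - 2) * ln (v - u)) = \<alpha> (1 - u) - \<alpha> (q - u)"
      using pq by (intro set_integral_FTC)
        (auto intro!: continuous_intros DERIV_chain'[where f = "\<lambda>v. v - u" and g = \<alpha> and D = 1, simplified]
          derivative_eq_intros d\<alpha>)
  qed
  \<comment> \<open>Differentiating \<open>\<beta> (r - u)\<close> in \<open>u\<close> flips the
    sign, so \<open>\<beta> (q - u) - \<beta> (1 - u)\<close> is the antiderivative. Of the four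
    corner values only \<open>\<beta> 1\<close> has no logarithm, since \<open>ln 1 = 0\<close>; the
    pure powers add up to \<open>H n p q\<close>.\<close>
  also have "\<dots> = (\<beta> (q - p) - \<beta> (1 - p)) - (\<beta> (q - 0) - \<beta> (1 - 0))"
  proof (rule set_integral_FTC)
    fix u assume u: "0 \<le> u" "u \<le> p"
    have "((\<lambda>u. \<beta> (r - u)) has_real_derivative \<alpha> (r - u) * (- 1)) (at u)" if "r \<ge> q" for r
      using pq u that by (intro DERIV_chain2[OF d\<beta>]) (auto intro!: derivative_eq_intros)
    from DERIV_diff[OF this[of q] this[of 1]] pq
    show "((\<lambda>u. \<beta> (q - u) - \<beta> (1 - u)) has_real_derivative \<alpha> (1 - u) - \<alpha> (q - u)) (at u)"
      by simp
  qed (use pq in \<open>auto intro!: continuous_intros c\<alpha>\<close>)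
  also have "\<dots> = ((q - p) ^ n * ln (q - p) - (1 - p) ^ n * ln (1 - p) - q ^ n * ln q) / (N * (N - 1))
      - (2 * N - 1) * H n p q / (N * (N - 1)) ^ 2"
    unfolding \<beta>_def H_def by (simp add: diff_divide_distrib add_divide_distrib algebra_simps)
  finally show ?thesis by (simp add: N_def)
qed

section \<open>Mutual information of the uniform minimum and maximum\<close>

text \<open>The densities of the minimum and maximum of \<open>n\<close> uniform variables on \<open>[0, 1]\<close>, conditional on
  minimum \<open>\<le> p\<close> and maximum \<open>> q\<close>, without the indicator of the box.\<close>

definition unif_joint :: "nat \<Rightarrow> real \<Rightarrow> real \<Rightarrow> real \<Rightarrow> real \<Rightarrow> real" where
  "unif_joint n p q u v = real n * (real n - 1) / H n p q * (v - u) ^ (n - 2)"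

definition unif_min :: "nat \<Rightarrow> real \<Rightarrow> real \<Rightarrow> real \<Rightarrow> real" where
  "unif_min n p q u = real n / H n p q * ((1 - u) ^ (n - 1) - (q - u) ^ (n - 1))"

definition unif_max :: "nat \<Rightarrow> real \<Rightarrow> real \<Rightarrow> real \<Rightarrow> real" where
  "unif_max n p q v = real n / H n p q * (v ^ (n - 1) - (v - p) ^ (n - 1))"

context
  fixes n :: nat and p q :: real
  assumes n: "2 \<le> n" and pq: "0 < p" "p < q" "q < 1"
begin

lemma power_gap_pos:
  shows "u \<le> p \<Longrightarrow> (q - u) ^ (n - 1) < (1 - u) ^ (n - 1)"
    and "q \<le> v \<Longrightarrow> (v - p) ^ (n - 1) < v ^ (n - 1)"
  using n pq by (auto intro!: power_strict_mono)

lemma unif_marginal_pos: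
  shows "u \<le> p \<Longrightarrow> unif_min n p q u > 0" "q \<le> v \<Longrightarrow> unif_max n p q v > 0"
  using power_gap_pos(1)[of u] power_gap_pos(2)[of v] H_pos[OF n pq] n
  by (auto simp: unif_min_def unif_max_def)

lemma unif_joint_pos: "u \<le> p \<Longrightarrow> q \<le> v \<Longrightarrow> unif_joint n p q u v > 0"
  using H_pos[OF n pq] n pq by (auto simp: unif_joint_def intro!: mult_pos_pos divide_pos_pos)

text \<open>All three densities are strictly positive on the closed box, so the logarithm is
  continuous there; compactness then gives integrability.\<close>

lemma continuous_on_unif_mi:
  "continuous_on ({0..p} \<times> {q..1}) (\<lambda>(u, v). unif_joint n p q u v * ln (unif_joint n p q u v / (unif_min n p q u * unif_max n p q v)))"
proof -
  have "unif_joint n p q u v \<noteq> 0" "unif_min n p q u \<noteq> 0" "unif_max n p q v \<noteq> 0" if "(u, v) \<in> {0..p} \<times> {q..1}" for u v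
    using unif_marginal_pos(1)[of u] unif_marginal_pos(2)[of v] unif_joint_pos[of u v] that by auto
  moreover have "H n p q \<noteq> 0" using H_pos[OF n pq] by simp
  ultimately show ?thesis
    using n pq unfolding split_beta
    by (intro continuous_intros) (auto simp: unif_joint_def unif_min_def unif_max_def intro!: continuous_intros)
qed

lemma integral_unif_mi:
  "(\<integral>(u, v). indicator {0..p} u * (indicator {q..1} v *
      (unif_joint n p q u v * ln (unif_joint n p q u v / (unif_min n p q u * unif_max n p q v)))) \<partial>(lborel \<Otimes>\<^sub>M lborel)) =
   ln ((real n - 1) / real n * H n p q)
           - (real n - 2) * (2 * real n - 1) / (real n * (real n - 1))
           - real n / H n p q *
               (K n p q + K n (1 - q) (1 - p)
                + (real n - 2) / real n *
                    ((1 - p) ^ n * ln (1 - p) + q ^ n * ln q - (q - p) ^ n * ln (q - p)))"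
proof -
  define N where "N = real n"
  have N: "N \<ge> 2" using n by (simp add: N_def)
  define h where "h = H n p q"
  have h: "h > 0" using H_pos[OF n pq] by (simp add: h_def)
  \<comment> \<open>\<open>K n p q\<close> is the integral of \<open>A ln A\<close>, and \<open>K n (1 - q) (1 - p)\<close> that of \<open>B ln B\<close> after \<open>v = 1 - w\<close>.\<close>
  define A where "A u = (1 - u) ^ (n - 1) - (q - u) ^ (n - 1)" for u
  define B where "B v = v ^ (n - 1) - (v - p) ^ (n - 1)" for v
  have A: "A u > 0" if "u \<le> p" for u
    using power_gap_pos(1)[OF that] by (simp add: A_def)
  have B: "B v > 0" if "q \<le> v" for v
    using power_gap_pos(2)[OF that] by (simp add: B_def)
  define L where "L = ln ((N - 1) / N * h)"
  define T1 where "T1 u v = (v - u) ^ (n - 2)" for u v :: real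
  define T2 where "T2 u v = (v - u) ^ (n - 2) * ln (v - u)" for u v :: real
  define T3 where "T3 u v = (v - u) ^ (n - 2) * ln (A u)" for u v :: real
  define T4 where "T4 u v = (v - u) ^ (n - 2) * ln (B v)" for u v :: real
  let ?I = "\<lambda>T (u, v). indicator {0..p} u * (indicator {q..1} v * T u v) :: real"
  have decomp: "unif_joint n p q u v * ln (unif_joint n p q u v / (unif_min n p q u * unif_max n p q v)) =
      N * (N - 1) / h * (L * T1 u v + (N - 2) * T2 u v - T3 u v - T4 u v)"
    if "u \<in> {0..p}" "v \<in> {q..1}" for u v
  proof -
    have d: "v - u > 0" using that pq by auto
    \<comment> \<open>The normalising constants leave
      \<open>(n * (n - 1) / h) / (n / h) ^ 2 = (n - 1) / n * h\<close>, the argument of the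
      logarithm \<open>L\<close>.\<close>
    have "unif_joint n p q u v / (unif_min n p q u * unif_max n p q v) =
        ((N - 1) / N * h) * (v - u) ^ (n - 2) / (A u * B v)"
      using N h unfolding unif_joint_def unif_min_def unif_max_def
      by (simp add: A_def B_def N_def h_def divide_simps)
    also have "ln \<dots> = L + (N - 2) * ln (v - u) - ln (A u) - ln (B v)"
      using d N h A[of u] B[of v] that n
      by (simp add: L_def ln_div ln_mult ln_realpow N_def of_nat_diff)
    finally have ln_eq: "ln (unif_joint n p q u v / (unif_min n p q u * unif_max n p q v)) = \<dots>" .
    define c where "c = N * (N - 1) / h"
    have "unif_joint n p q u v = c * (v - u) ^ (n - 2)"
      by (simp add: unif_joint_def c_def N_def h_def)
    then show ?thesis
      unfolding ln_eq c_def[symmetric] by (simp add: T1_def T2_def T3_def T4_def algebra_simps)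
  qed
  \<comment> \<open>Each of the fact lists \<open>1\<close> to \<open>4\<close> holds integrability,
    the iterated integral with \<open>v\<close> innermost, and the one with \<open>u\<close>
    innermost, in this order.\<close>
  have "continuous_on ({0..p} \<times> {q..1}) (\<lambda>(u, v). T1 u v)"
    unfolding T1_def split_beta by (intro continuous_intros)
  note 1 = box_integrable[OF this] box_integral[OF this]
  have "continuous_on ({0..p} \<times> {q..1}) (\<lambda>(u, v). T2 u v)"
    unfolding T2_def split_beta using pq by (auto intro!: continuous_intros)
  note 2 = box_integrable[OF this] box_integral[OF this]
  have "continuous_on ({0..p} \<times> {q..1}) (\<lambda>(u, v). T3 u v)"
    using A unfolding T3_def split_beta A_def by (auto intro!: continuous_intros simp: less_le)
  note 3 = box_integrable[OF this] box_integral[OF this]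
  have "continuous_on ({0..p} \<times> {q..1}) (\<lambda>(u, v). T4 u v)"
    using B unfolding T4_def split_beta B_def by (auto intro!: continuous_intros simp: less_le)
  note 4 = box_integrable[OF this] box_integral[OF this]
  have right: "(LBINT v:{q..1}. (v - u) ^ (n - 2)) = A u / (N - 1)" if "u \<in> {0..p}" for u
    using that pq by (subst set_integral_FTC[OF _ DERIV_power_gap(1)[OF n]])
      (auto intro!: continuous_intros simp: A_def N_def diff_divide_distrib)
  have left: "(LBINT u:{0..p}. (v - u) ^ (n - 2)) = B v / (N - 1)" if "v \<in> {q..1}" for v
    using that pq by (subst set_integral_FTC[OF _ DERIV_power_gap(2)[OF n]])
      (auto intro!: continuous_intros simp: B_def N_def diff_divide_distrib)
  have I1: "integral\<^sup>L (lborel \<Otimes>\<^sub>M lborel) (?I T1) = h / (N * (N - 1))"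
  proof -
    have "integral\<^sup>L (lborel \<Otimes>\<^sub>M lborel) (?I T1) = (LBINT u:{0..p}. A u / (N - 1))"
      unfolding 1(2) unfolding T1_def by (intro set_lebesgue_integral_cong) (auto simp: right)
    also have "\<dots> = ((q - p) ^ n - (1 - p) ^ n) / (N * (N - 1)) - ((q - 0) ^ n - (1 - 0) ^ n) / (N * (N - 1))"
      using n pq unfolding A_def N_def
      by (intro set_integral_FTC DERIV_H n) (auto intro!: continuous_intros)
    finally show ?thesis
      by (simp add: h_def H_def diff_divide_distrib add_divide_distrib algebra_simps)
  qed
  have I2: "integral\<^sup>L (lborel \<Otimes>\<^sub>M lborel) (?I T2) =
    ((q - p) ^ n * ln (q - p) - (1 - p) ^ n * ln (1 - p) - q ^ n * ln q) / (N * (N - 1))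
      - (2 * N - 1) * h / (N * (N - 1)) ^ 2"
    unfolding 2(2) unfolding T2_def N_def h_def by (rule integral_power_gap_ln[OF n pq])
  \<comment> \<open>In \<open>T3\<close> the logarithm depends on \<open>u\<close> alone, so
    \<open>v\<close> is integrated first and leaves \<open>A u / (N - 1)\<close>. In
    \<open>T4\<close> it depends on \<open>v\<close> alone and the order is reversed.\<close>
  have I3: "integral\<^sup>L (lborel \<Otimes>\<^sub>M lborel) (?I T3) = K n p q / (N - 1)"
  proof -
    have "integral\<^sup>L (lborel \<Otimes>\<^sub>M lborel) (?I T3) = (LBINT u:{0..p}. A u * ln (A u) / (N - 1))"
      unfolding 3(2) unfolding T3_def by (intro set_lebesgue_integral_cong) (auto simp: right)
    then show ?thesis by (simp add: K_def A_def)
  qed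
  have I4: "integral\<^sup>L (lborel \<Otimes>\<^sub>M lborel) (?I T4) = K n (1 - q) (1 - p) / (N - 1)"
  proof -
    have "integral\<^sup>L (lborel \<Otimes>\<^sub>M lborel) (?I T4) = (LBINT v:{q..1}. B v * ln (B v) / (N - 1))"
      unfolding 4(3) unfolding T4_def by (intro set_lebesgue_integral_cong) (auto simp: left)
    then show ?thesis by (simp add: set_integral_K[symmetric] B_def)
  qed
  have "(\<integral>(u, v). indicator {0..p} u * (indicator {q..1} v *
      (unif_joint n p q u v * ln (unif_joint n p q u v / (unif_min n p q u * unif_max n p q v)))) \<partial>(lborel \<Otimes>\<^sub>M lborel)) =
    (\<integral>z. N * (N - 1) / h * (L * ?I T1 z + (N - 2) * ?I T2 z - ?I T3 z - ?I T4 z) \<partial>(lborel \<Otimes>\<^sub>M lborel))"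
    by (intro Bochner_Integration.integral_cong) (auto simp: decomp split: split_indicator)
  also have "\<dots> = N * (N - 1) / h * (L * integral\<^sup>L (lborel \<Otimes>\<^sub>M lborel) (?I T1)
      + (N - 2) * integral\<^sup>L (lborel \<Otimes>\<^sub>M lborel) (?I T2)
      - integral\<^sup>L (lborel \<Otimes>\<^sub>M lborel) (?I T3) - integral\<^sup>L (lborel \<Otimes>\<^sub>M lborel) (?I T4))"
    using 1(1) 2(1) 3(1) 4(1) by simp
  \<comment> \<open>The prefactor \<open>N * (N - 1) / h\<close> cancels the mass of
    \<open>T1\<close>, turns the \<open>1 / (N - 1)\<close> of the \<open>K\<close>-terms into
    \<open>N / h\<close>, and turns the power part of \<open>T2\<close> into the constant free of
    \<open>p\<close> and \<open>q\<close>.\<close>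
  also have "\<dots> = L - (N - 2) * (2 * N - 1) / (N * (N - 1))
    - N / h * (K n p q + K n (1 - q) (1 - p) + (N - 2) / N *
      ((1 - p) ^ n * ln (1 - p) + q ^ n * ln q - (q - p) ^ n * ln (q - p)))"
    unfolding I1 I2 I3 I4 using N h
    by (simp add: divide_simps power2_eq_square) (simp add: algebra_simps)
  finally show ?thesis by (simp add: L_def N_def h_def)
qed

end

section \<open>The probability integral transform\<close>

text \<open>Continuity of the distribution function \<open>C\<close> is expressed as absence of
  atoms. \<open>C\<close> may still have flat pieces, so its generalized inverse \<open>I\<close>
  need not be a two-sided inverse.\<close>

locale continuous_cdf_distribution = cdf_distribution +
  assumes no_atom: "measure M {x} = 0"
begin

text \<open>By the Galois connection \<open>w \<le> C x \<longleftrightarrow> I w \<le> x\<close>,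
  \<open>C\<close> is at least \<open>w\<close> at \<open>I w\<close> and below \<open>w\<close> to
  its left. Continuity carries the upper bound to \<open>I w\<close> itself.\<close>

lemma cdf_quantile:
  assumes "0 < w" "w < 1"
  shows "C (I w) = w"
proof (rule antisym)
  show "w \<le> C (I w)" using pseudoinverse[OF assms] by blast
  have below: "C x \<le> w" if "x < I w" for x
    using pseudoinverse[OF assms, of x] that by simp
  have "isCont C (I w)" using isCont_cdf no_atom by blast
  then have "(C \<longlongrightarrow> C (I w)) (at_left (I w))"
    by (simp add: continuous_at filterlim_at_split)
  moreover have "\<forall>\<^sub>F x in at_left (I w). C x \<le> w"
    using below by (auto simp: eventually_at_filter)
  ultimately show "C (I w) \<le> w" by (rule tendsto_upperbound) simp
qed

text \<open>\<open>M\<close> is the image under \<open>I\<close> of the uniform law on the open unit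
  interval, and \<open>C\<close> undoes \<open>I\<close> there.\<close>

lemma distr_cdf: "distr M borel C = density lborel (indicator {0..1})" (is "_ = ?U")
proof -
  let ?R = "restrict_space lborel {0<..<1::real}"
  have I[measurable]: "I \<in> borel_measurable ?R"
    using measurable_CI by (simp cong: measurable_cong_sets sets_restrict_space_cong)
  have "distr M borel C = distr (distr ?R borel I) borel C"
    by (simp add: distr_I_eq_M)
  also have "\<dots> = distr ?R borel (C \<circ> I)"
    by (intro distr_distr) auto
  also have "\<dots> = distr ?R borel (\<lambda>x. x)"
    by (intro distr_cong) (auto simp: space_restrict_space cdf_quantile)
  also have "\<dots> = ?U"
  proof (rule measure_eqI)
    fix A :: "real set" assume "A \<in> sets (distr ?R borel (\<lambda>x. x))"
    then have [measurable]: "A \<in> sets borel" by simp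
    have [measurable]: "(\<lambda>x. x) \<in> borel_measurable ?R"
      by (intro measurable_restrict_space1) auto
    have "emeasure (distr ?R borel (\<lambda>x. x)) A = emeasure lborel ({0<..<1} \<inter> A)"
      by (subst emeasure_distr) (auto simp: space_restrict_space emeasure_restrict_space Int_commute)
    \<comment> \<open>Adding the two endpoints changes only a null set.\<close>
    also have "\<dots> = emeasure lborel ({0..1} \<inter> A)"
      using AE_lborel_singleton[of "0::real"] AE_lborel_singleton[of "1::real"]
      by (intro emeasure_eq_AE) auto
    also have "\<dots> = (\<integral>\<^sup>+u. indicator {0..1} u * indicator A u \<partial>lborel)"
      by (simp add: indicator_inter_arith[symmetric])
    also have "\<dots> = emeasure ?U A"
      by (simp add: emeasure_density)
    finally show "emeasure (distr ?R borel (\<lambda>x. x)) A = emeasure ?U A" .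
  qed simp
  finally show ?thesis .
qed

text \<open>The uniform law has no atoms, so every level set of \<open>C\<close>, in particular
  every flat piece, carries no mass.\<close>

lemma AE_cdf_neq: "AE x in M. C x \<noteq> w"
proof -
  have "AE u in distr M borel C. u \<noteq> w"
    unfolding distr_cdf using AE_lborel_singleton[of w] by (subst AE_density) auto
  then show ?thesis by (simp add: AE_distr_iff)
qed

lemma nn_integral_cdf:
  assumes [measurable]: "\<psi> \<in> borel_measurable borel"
  shows "(\<integral>\<^sup>+x. \<psi> (C x) \<partial>M) = (\<integral>\<^sup>+u. \<psi> u * indicator {0..1} u \<partial>lborel)"
proof -
  have "(\<integral>\<^sup>+x. \<psi> (C x) \<partial>M) = (\<integral>\<^sup>+u. \<psi> u \<partial>distr M borel C)"
    by (simp add: nn_integral_distr)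
  then show ?thesis
    unfolding distr_cdf by (simp add: nn_integral_density mult.commute)
qed

text \<open>Monotonicity gives one direction. The converse can fail only where
  \<open>C x = C a\<close>, which is a null event.\<close>

lemma AE_le_iff_cdf_le: "AE x in M. x \<le> a \<longleftrightarrow> C x \<le> C a"
  using AE_cdf_neq[of "C a"]
  by eventually_elim (metis antisym cdf_nondecreasing linear)

lemma nn_integral_atMost_cdf:
  assumes [measurable]: "\<psi> \<in> borel_measurable borel"
  shows "(\<integral>\<^sup>+x. \<psi> (C x) * indicator {..a} x \<partial>M) = (\<integral>\<^sup>+u. \<psi> u * indicator {0..C a} u \<partial>lborel)"
proof -
  have "(\<integral>\<^sup>+x. \<psi> (C x) * indicator {..a} x \<partial>M) = (\<integral>\<^sup>+x. \<psi> (C x) * indicator {..C a} (C x) \<partial>M)"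
    using AE_le_iff_cdf_le[of a] by (intro nn_integral_cong_AE) (auto split: split_indicator)
  also have "\<dots> = (\<integral>\<^sup>+u. \<psi> u * indicator {..C a} u * indicator {0..1} u \<partial>lborel)"
    by (rule nn_integral_cdf) simp
  also have "\<dots> = (\<integral>\<^sup>+u. \<psi> u * indicator {0..C a} u \<partial>lborel)"
    using cdf_bounded_prob[of a] by (intro nn_integral_cong) (auto split: split_indicator)
  finally show ?thesis .
qed

text \<open>The open half-line becomes a closed interval because the level \<open>C b\<close> has
  probability zero.\<close>

lemma nn_integral_greaterThan_cdf:
  assumes [measurable]: "\<psi> \<in> borel_measurable borel"
  shows "(\<integral>\<^sup>+x. \<psi> (C x) * indicator {b<..} x \<partial>M) = (\<integral>\<^sup>+u. \<psi> u * indicator {C b..1} u \<partial>lborel)"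
proof -
  have "(\<integral>\<^sup>+x. \<psi> (C x) * indicator {b<..} x \<partial>M) = (\<integral>\<^sup>+x. \<psi> (C x) * indicator {C b..} (C x) \<partial>M)"
    using AE_le_iff_cdf_le[of b] AE_cdf_neq[of "C b"]
    by (intro nn_integral_cong_AE) (auto simp: not_less not_le split: split_indicator)
  also have "\<dots> = (\<integral>\<^sup>+u. \<psi> u * indicator {C b..} u * indicator {0..1} u \<partial>lborel)"
    by (rule nn_integral_cdf) simp
  also have "\<dots> = (\<integral>\<^sup>+u. \<psi> u * indicator {C b..1} u \<partial>lborel)"
    using cdf_nonneg[of b] by (intro nn_integral_cong) (auto split: split_indicator)
  finally show ?thesis .
qed

lemma distr_cdf_pair:
  "distr (M \<Otimes>\<^sub>M M) (borel \<Otimes>\<^sub>M borel) (\<lambda>(x, y). (C x, C y)) =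
    density (lborel \<Otimes>\<^sub>M lborel) (\<lambda>(u, v). indicator {0..1} u * indicator {0..1} v)"
proof -
  have fin: "sigma_finite_measure (distr M borel C)"
    by (intro prob_space_imp_sigma_finite prob_space_distr) simp
  have "distr (M \<Otimes>\<^sub>M M) (borel \<Otimes>\<^sub>M borel) (\<lambda>(x, y). (C x, C y)) = distr M borel C \<Otimes>\<^sub>M distr M borel C"
    by (rule pair_measure_distr[OF _ _ fin, symmetric]) auto
  also have "\<dots> = density (lborel \<Otimes>\<^sub>M lborel) (\<lambda>(u, v). indicator {0..1} u * indicator {0..1} v)"
    using fin unfolding distr_cdf by (intro pair_measure_density) (auto intro: sigma_finite_lborel)
  finally show ?thesis .
qed

lemma integral_cdf_pair:
  fixes J :: "real \<Rightarrow> real \<Rightarrow> real"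
  assumes J[measurable]: "(\<lambda>(u, v). J u v) \<in> borel_measurable (borel \<Otimes>\<^sub>M borel)"
    and int: "integrable (lborel \<Otimes>\<^sub>M lborel) (\<lambda>(u, v). indicator {0..1} u * indicator {0..1} v * J u v)"
  shows "integrable (M \<Otimes>\<^sub>M M) (\<lambda>(x, y). J (C x) (C y))"
    and "(\<integral>(x, y). J (C x) (C y) \<partial>(M \<Otimes>\<^sub>M M)) =
      (\<integral>(u, v). indicator {0..1} u * indicator {0..1} v * J u v \<partial>(lborel \<Otimes>\<^sub>M lborel))"
proof -
  let ?T = "\<lambda>(x, y). (C x, C y)"
  have T[measurable]: "?T \<in> measurable (M \<Otimes>\<^sub>M M) (borel \<Otimes>\<^sub>M borel)"
    by simp
  \<comment> \<open>The rules for real integrals against a density take the weight as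
    \<open>ennreal\<close> of a real function.\<close>
  have w: "(\<lambda>(u, v). indicator {0..1} u * indicator {0..1} v :: ennreal) =
      (\<lambda>z. ennreal (indicator {0..1::real} (fst z) * indicator {0..1::real} (snd z)))"
    by (auto simp: fun_eq_iff split: split_indicator)
  have comp: "(\<lambda>(x, y). J (C x) (C y)) = (\<lambda>z. (case ?T z of (u, v) \<Rightarrow> J u v))"
    by (auto simp: fun_eq_iff)
  have J': "(\<lambda>(u, v). J u v) \<in> borel_measurable (lborel \<Otimes>\<^sub>M lborel)"
    using J by (simp cong: measurable_cong_sets sets_pair_measure_cong)
  have int': "integrable (lborel \<Otimes>\<^sub>M lborel)
      (\<lambda>z. indicator {0..1::real} (fst z) * indicator {0..1::real} (snd z) * (case z of (u, v) \<Rightarrow> J u v))"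
    using int by (simp add: case_prod_unfold)
  show "integrable (M \<Otimes>\<^sub>M M) (\<lambda>(x, y). J (C x) (C y))"
    unfolding comp integrable_distr_eq[OF T J, symmetric] distr_cdf_pair w
    using int' J' by (subst integrable_real_density) (auto simp: indicator_def)
  show "(\<integral>(x, y). J (C x) (C y) \<partial>(M \<Otimes>\<^sub>M M)) =
      (\<integral>(u, v). indicator {0..1} u * indicator {0..1} v * J u v \<partial>(lborel \<Otimes>\<^sub>M lborel))"
    unfolding comp integral_distr[OF T J, symmetric] distr_cdf_pair w
    using J' by (subst integral_real_density) (auto simp: case_prod_unfold)
qed

end

section \<open>Minimum and maximum of an i.i.d. sample\<close>

locale iid_sample = prob_space M for M :: "'a measure" +
  fixes X :: "nat \<Rightarrow> 'a \<Rightarrow> real" and n :: nat and f :: "real \<Rightarrow> real"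
  assumes n: "2 \<le> n"
    and indep: "indep_vars (\<lambda>_. borel) X {1..n}"
    and f_nonneg: "\<And>x. 0 \<le> f x"
    and dens: "\<And>i. i \<in> {1..n} \<Longrightarrow> distributed M lborel (X i) (\<lambda>x. ennreal (f x))"
begin

abbreviation "law \<equiv> density lborel (\<lambda>x. ennreal (f x))"
abbreviation "F \<equiv> cdf law"
abbreviation "Y \<equiv> sample_min X n"
abbreviation "Z \<equiv> sample_max X n"

lemma X_measurable: "i \<in> {1..n} \<Longrightarrow> X i \<in> borel_measurable M"
  using distributed_measurable[OF dens] by simp

lemma distr_X: "i \<in> {1..n} \<Longrightarrow> distr M borel (X i) = law"
  using distributed_distr_eq_density[OF dens] by (simp cong: distr_cong)

lemma f_measurable[measurable]: "f \<in> borel_measurable borel"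
proof -
  have "(\<lambda>x. enn2real (ennreal (f x))) \<in> borel_measurable borel"
    using distributed_borel_measurable[OF dens, of 1] n by (intro measurable_compose[OF _ borel_measurable_enn2real]) auto
  then show ?thesis by (simp add: f_nonneg)
qed

lemma prob_space_law: "prob_space law"
  using distr_X[of 1] X_measurable[of 1] n by (metis atLeastAtMost_iff le_refl one_le_numeral order_trans prob_space_distr)

text \<open>Absolute continuity excludes atoms, which makes the transform results available for
  \<open>law\<close>.\<close>

sublocale law: continuous_cdf_distribution law
proof -
  interpret law: prob_space law by (rule prob_space_law)
  show "continuous_cdf_distribution law"
  proof unfold_locales
    fix x
    have "AE y in lborel. ennreal (f y) * indicator {x} y = 0"
      using AE_lborel_singleton[of x] by eventually_elim auto
    then have "emeasure law {x} = 0"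
      by (simp add: emeasure_density nn_integral_0_iff_AE)
    then show "measure law {x} = 0" by (simp add: measure_def)
  qed auto
qed

lemma Y_measurable[measurable]: "Y \<in> borel_measurable M"
  using X_measurable n unfolding sample_min_def by (intro borel_measurable_Min) auto

lemma Z_measurable[measurable]: "Z \<in> borel_measurable M"
  using X_measurable n unfolding sample_max_def by (intro borel_measurable_Max) auto

lemma Y_greater_iff: "a < Y \<omega> \<longleftrightarrow> (\<forall>i\<in>{1..n}. a < X i \<omega>)"
  using n unfolding sample_min_def by (subst Min_gr_iff) auto

lemma Z_le_iff: "Z \<omega> \<le> b \<longleftrightarrow> (\<forall>i\<in>{1..n}. X i \<omega> \<le> b)"
  using n unfolding sample_max_def by (subst Max_le_iff) auto

lemma prob_all_in:
  assumes "B \<in> sets borel"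
  shows "prob {\<omega> \<in> space M. \<forall>i\<in>{1..n}. X i \<omega> \<in> B} = measure law B ^ n"
proof -
  have "{\<omega> \<in> space M. \<forall>i\<in>{1..n}. X i \<omega> \<in> B} = (\<Inter>i\<in>{1..n}. X i -` B \<inter> space M)"
    using n by auto
  also have "prob \<dots> = (\<Prod>i\<in>{1..n}. prob (X i -` B \<inter> space M))"
    using assms n by (intro indep_varsD_finite[OF indep]) auto
  also have "\<dots> = (\<Prod>i\<in>{1..n}. measure law B)"
    using assms X_measurable by (intro prod.cong) (auto simp: distr_X[symmetric] measure_distr)
  finally show ?thesis by simp
qed

text \<open>The complement is the union of \<open>a < Y\<close> and \<open>Z \<le> b\<close>. These
  events and their intersection each say that all observations lie in one interval, so independence
  gives \<open>n\<close>-th powers, and inclusion-exclusion combines them.\<close>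

lemma prob_min_le_max_greater:
  assumes "a \<le> b"
  shows "prob {\<omega> \<in> space M. Y \<omega> \<le> a \<and> b < Z \<omega>} = H n (F a) (F b)"
proof -
  have Ioc: "measure law {a<..b} = F b - F a"
    using assms law.cdf_diff_eq[of a b] by (cases "a = b") auto
  have "prob {\<omega> \<in> space M. \<forall>i\<in>{1..n}. X i \<omega> \<in> {a<..b}} = (F b - F a) ^ n"
    by (subst prob_all_in) (auto simp: Ioc)
  moreover have "{\<omega> \<in> space M. \<forall>i\<in>{1..n}. X i \<omega> \<in> {a<..b}} = {\<omega> \<in> space M. a < Y \<omega> \<and> Z \<omega> \<le> b}"
    by (auto simp: Y_greater_iff Z_le_iff)
  ultimately have 1: "prob {\<omega> \<in> space M. a < Y \<omega> \<and> Z \<omega> \<le> b} = (F b - F a) ^ n" by simp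
  have "measure law {a<..} = 1 - F a"
    using law.prob_compl[of "{..a}"] by (simp add: cdf_def Compl_eq_Diff_UNIV[symmetric])
  then have "prob {\<omega> \<in> space M. \<forall>i\<in>{1..n}. X i \<omega> \<in> {a<..}} = (1 - F a) ^ n"
    by (subst prob_all_in) auto
  then have 2: "prob {\<omega> \<in> space M. a < Y \<omega>} = (1 - F a) ^ n"
    by (simp add: Y_greater_iff)
  have "prob {\<omega> \<in> space M. \<forall>i\<in>{1..n}. X i \<omega> \<in> {..b}} = F b ^ n"
    by (subst prob_all_in) (auto simp: cdf_def)
  then have 3: "prob {\<omega> \<in> space M. Z \<omega> \<le> b} = F b ^ n"
    by (simp add: Z_le_iff)
  have "prob ({\<omega> \<in> space M. a < Y \<omega>} \<union> {\<omega> \<in> space M. Z \<omega> \<le> b}) = (1 - F a) ^ n + F b ^ n - (F b - F a) ^ n"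
  proof -
    have "{\<omega> \<in> space M. a < Y \<omega>} \<inter> {\<omega> \<in> space M. Z \<omega> \<le> b} = {\<omega> \<in> space M. a < Y \<omega> \<and> Z \<omega> \<le> b}"
      by auto
    then show ?thesis
      using measure_Un3[of "{\<omega> \<in> space M. a < Y \<omega>}" M "{\<omega> \<in> space M. Z \<omega> \<le> b}"] 1 2 3
      by (simp add: fmeasurable_eq_sets)
  qed
  moreover have "{\<omega> \<in> space M. Y \<omega> \<le> a \<and> b < Z \<omega>} =
      space M - ({\<omega> \<in> space M. a < Y \<omega>} \<union> {\<omega> \<in> space M. Z \<omega> \<le> b})"
    by (auto simp: not_le not_less)
  ultimately show ?thesis
    by (simp add: H_def prob_compl)
qed

section \<open>Masses of the candidate joint density\<close>

text \<open>For \<open>F b = q\<close> the right-hand side is \<open>unif_min n p q (F x)\<close>.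
  The bound \<open>b\<close> stays free because arbitrary quadrants are needed to identify the
  law.\<close>

lemma nn_integral_unif_joint_right:
  assumes "0 \<le> H n p q" "x \<le> b"
  shows "(\<integral>\<^sup>+y. ennreal (f y) * (ennreal (unif_joint n p q (F x) (F y)) * indicator {b<..} y) \<partial>lborel) =
    ennreal (real n / H n p q * ((1 - F x) ^ (n - 1) - (F b - F x) ^ (n - 1)))"
proof -
  let ?c = "real n * (real n - 1) / H n p q"
  have c: "?c \<ge> 0" using assms n by simp
  have le: "F x \<le> F b" using assms law.cdf_nondecreasing by blast
  have "(\<integral>\<^sup>+y. ennreal (f y) * (ennreal (unif_joint n p q (F x) (F y)) * indicator {b<..} y) \<partial>lborel) =
      (\<integral>\<^sup>+y. ennreal (unif_joint n p q (F x) (F y)) * indicator {b<..} y \<partial>law)"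
    by (subst nn_integral_density) (auto simp: unif_joint_def)
  also have "\<dots> = (\<integral>\<^sup>+v. ennreal (unif_joint n p q (F x) v) * indicator {F b..1} v \<partial>lborel)"
    by (rule law.nn_integral_greaterThan_cdf) (simp add: unif_joint_def)
  also have "\<dots> = (\<integral>\<^sup>+v. ennreal ?c * (ennreal ((v - F x) ^ (n - 2)) * indicator {F b..1} v) \<partial>lborel)"
    using c le by (intro nn_integral_cong) (auto simp: unif_joint_def ennreal_mult[symmetric] split: split_indicator)
  also have "\<dots> = ennreal ?c * ennreal (((1 - F x) ^ (n - 1) - (F b - F x) ^ (n - 1)) / (real n - 1))"
    using n le law.cdf_bounded_prob
    by (subst nn_integral_cmult) (auto simp: nn_integral_power_gap_right)
  also have "\<dots> = ennreal (real n / H n p q * ((1 - F x) ^ (n - 1) - (F b - F x) ^ (n - 1)))"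
    using n c le law.cdf_bounded_prob[of x] law.cdf_bounded_prob[of b] by (subst ennreal_mult[symmetric]) (auto intro!: power_mono divide_nonneg_nonneg)
  finally show ?thesis .
qed

lemma nn_integral_unif_joint_left:
  assumes "0 \<le> H n p q" "a \<le> y"
  shows "(\<integral>\<^sup>+x. ennreal (f x) * (ennreal (unif_joint n p q (F x) (F y)) * indicator {..a} x) \<partial>lborel) =
    ennreal (real n / H n p q * (F y ^ (n - 1) - (F y - F a) ^ (n - 1)))"
proof -
  let ?c = "real n * (real n - 1) / H n p q"
  have c: "?c \<ge> 0" using assms n by simp
  have le: "F a \<le> F y" using assms law.cdf_nondecreasing by blast
  have "(\<integral>\<^sup>+x. ennreal (f x) * (ennreal (unif_joint n p q (F x) (F y)) * indicator {..a} x) \<partial>lborel) =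
      (\<integral>\<^sup>+x. ennreal (unif_joint n p q (F x) (F y)) * indicator {..a} x \<partial>law)"
    by (subst nn_integral_density) (auto simp: unif_joint_def)
  also have "\<dots> = (\<integral>\<^sup>+u. ennreal (unif_joint n p q u (F y)) * indicator {0..F a} u \<partial>lborel)"
    by (rule law.nn_integral_atMost_cdf) (simp add: unif_joint_def)
  also have "\<dots> = (\<integral>\<^sup>+u. ennreal ?c * (ennreal ((F y - u) ^ (n - 2)) * indicator {0..F a} u) \<partial>lborel)"
    using c le by (intro nn_integral_cong) (auto simp: unif_joint_def ennreal_mult[symmetric] split: split_indicator)
  also have "\<dots> = ennreal ?c * ennreal ((F y ^ (n - 1) - (F y - F a) ^ (n - 1)) / (real n - 1))"
    using n le law.cdf_nonneg
    by (subst nn_integral_cmult) (auto simp: nn_integral_power_gap_left)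
  also have "\<dots> = ennreal (real n / H n p q * (F y ^ (n - 1) - (F y - F a) ^ (n - 1)))"
    using n c le law.cdf_nonneg[of a] by (subst ennreal_mult[symmetric]) (auto intro!: power_mono divide_nonneg_nonneg)
  finally show ?thesis .
qed

text \<open>The result is the same quotient of \<open>H\<close>-values as the conditional
  probability obtained from \<open>prob_min_le_max_greater\<close>. Here \<open>p\<close> and
  \<open>q\<close> enter through the normalisation, while \<open>a\<close> and \<open>b\<close>
  vary.\<close>

lemma nn_integral_unif_joint_rect:
  assumes H: "0 \<le> H n p q" and "a \<le> b"
  shows "(\<integral>\<^sup>+x. ennreal (f x) * indicator {..a} x *
      (\<integral>\<^sup>+y. ennreal (f y) * (ennreal (unif_joint n p q (F x) (F y)) * indicator {b<..} y) \<partial>lborel) \<partial>lborel) =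
    ennreal (H n (F a) (F b) / H n p q)"
proof -
  let ?c = "real n * (real n - 1) / H n p q"
  have c: "?c \<ge> 0" using H n by simp
  have le: "F a \<le> F b" using assms law.cdf_nondecreasing by blast
  let ?g = "\<lambda>u. ((1 - u) ^ (n - 1) - (F b - u) ^ (n - 1)) / (real n - 1)"
  have "(\<integral>\<^sup>+x. ennreal (f x) * indicator {..a} x *
      (\<integral>\<^sup>+y. ennreal (f y) * (ennreal (unif_joint n p q (F x) (F y)) * indicator {b<..} y) \<partial>lborel) \<partial>lborel) =
    (\<integral>\<^sup>+x. ennreal (f x) * (ennreal (?c * ?g (F x)) * indicator {..a} x) \<partial>lborel)"
    using n assms by (intro nn_integral_cong) (auto simp: nn_integral_unif_joint_right split: split_indicator)
  also have "\<dots> = (\<integral>\<^sup>+x. ennreal (?c * ?g (F x)) * indicator {..a} x \<partial>law)"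
    by (subst nn_integral_density) auto
  also have "\<dots> = (\<integral>\<^sup>+u. ennreal (?c * ?g u) * indicator {0..F a} u \<partial>lborel)"
    by (rule law.nn_integral_atMost_cdf) simp
  also have "\<dots> = (\<integral>\<^sup>+u. ennreal ?c * (ennreal (?g u) * indicator {0..F a} u) \<partial>lborel)"
    by (simp only: ennreal_mult'[OF c] mult.assoc)
  also have "\<dots> = ennreal ?c * ennreal (H n (F a) (F b) / (real n * (real n - 1)))"
    using law.cdf_bounded_prob
    by (subst nn_integral_cmult, simp, subst nn_integral_H[OF n law.cdf_nonneg le]) auto
  also have "\<dots> = ennreal (H n (F a) (F b) / H n p q)"
    using n c by (simp add: ennreal_mult'[symmetric])
  finally show ?thesis .
qed

text \<open>Quadrants of this orientation are exactly what the events \<open>Y \<le> a\<close>,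
  \<open>b < Z\<close> describe, so they are the natural generator for comparing laws of the
  pair.\<close>

lemma sigma_rects: "(borel :: (real \<times> real) measure) = sigma UNIV (range (\<lambda>(a, b). {..a} \<times> {b<..}))"
proof -
  \<comment> \<open>Countable covers by generators in each factor are the side conditions of
    \<open>sigma_prod\<close>.\<close>
  have "\<exists>E\<subseteq>range (\<lambda>a::real. {..a}). countable E \<and> UNIV = \<Union>E"
    by (intro exI[of _ "range (\<lambda>k::nat. {..real k})"]) (auto intro: real_arch_simple)
  moreover have "\<exists>E\<subseteq>range (\<lambda>b::real. {b<..}). countable E \<and> UNIV = \<Union>E"
  proof (intro exI[of _ "range (\<lambda>k::nat. {- real k<..})"] conjI)
    show "UNIV = \<Union>(range (\<lambda>k::nat. {- real k<..}))"
      using reals_Archimedean2 by (auto simp: minus_less_iff)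
  qed auto
  ultimately have "sigma UNIV (range (\<lambda>a::real. {..a})) \<Otimes>\<^sub>M sigma UNIV (range (\<lambda>b::real. {b<..})) =
      sigma (UNIV \<times> UNIV) {A \<times> B | A B. A \<in> range (\<lambda>a::real. {..a}) \<and> B \<in> range (\<lambda>b::real. {b<..})}"
    by (intro sigma_prod) auto
  also have "{A \<times> B | A B. A \<in> range (\<lambda>a::real. {..a}) \<and> B \<in> range (\<lambda>b::real. {b<..})} =
      range (\<lambda>(a, b). {..a} \<times> {b<..})"
    by auto
  finally show ?thesis
    by (simp add: borel_prod borel_eq_atMost[symmetric] borel_Ioi[symmetric])
qed

end

section \<open>The conditional law\<close>

lemma borel_measurable_rv_density[measurable]: "rv_density M Z \<in> borel_measurable borel"
  unfolding rv_density_def by measurable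

text \<open>Since \<open>P\<close> need not be measurable, it is replaced by avoidance of a
  measurable null set \<open>N\<close> before Fubini is applied.\<close>

lemma AE_lborel_pairI:
  fixes P :: "real \<Rightarrow> bool"
  assumes "AE x in lborel. P x"
  shows "AE z in lborel \<Otimes>\<^sub>M (lborel :: real measure). P (fst z)"
    and "AE z in (lborel :: real measure) \<Otimes>\<^sub>M lborel. P (snd z)"
proof -
  obtain N where N: "N \<in> null_sets lborel" "{x. \<not> P x} \<subseteq> N"
    using assms by (auto simp: eventually_ae_filter)
  then have [measurable]: "N \<in> sets borel" by auto
  have ae: "AE x in lborel. x \<notin> N" using N by (rule_tac AE_not_in)
  have "AE z in lborel \<Otimes>\<^sub>M (lborel :: real measure). fst z \<notin> N"
  proof (rule lborel_pair.AE_pair_measure)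
    show "AE x in lborel. AE y in lborel. fst (x, y :: real) \<notin> N"
      using ae by eventually_elim simp
  qed measurable
  then show "AE z in lborel \<Otimes>\<^sub>M (lborel :: real measure). P (fst z)"
    by eventually_elim (use N in auto)
  have "AE z in (lborel :: real measure) \<Otimes>\<^sub>M lborel. snd z \<notin> N"
  proof (rule lborel_pair.AE_pair_measure)
    show "AE x in lborel. AE y in lborel. snd (x :: real, y) \<notin> N"
      using ae by simp
  qed measurable
  then show "AE z in (lborel :: real measure) \<Otimes>\<^sub>M lborel. P (snd z)"
    by eventually_elim (use N in auto)
qed

text \<open>The thresholds are described by their levels; generalized inverses satisfy this by
  \<open>law.cdf_quantile\<close>.\<close>

locale iid_tail_sample = iid_sample +
  fixes s t p q :: real
  assumes F_s: "F s = p" and F_t: "F t = q" and pq: "0 < p" "p < q" "q < 1"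
begin

abbreviation "cond \<equiv> tail_cond M Y Z s t"

text \<open>The factor \<open>f x * f y\<close> is the Jacobian of the transform. The indicators
  keep the function nonnegative: for odd \<open>n\<close>, \<open>unif_joint\<close> is negative
  where \<open>F y < F x\<close>.\<close>

definition joint :: "real \<Rightarrow> real \<Rightarrow> real" where
  "joint x y = f x * f y * (indicator {..s} x * indicator {t<..} y * unif_joint n p q (F x) (F y))"

definition marg_min :: "real \<Rightarrow> real" where
  "marg_min x = f x * (indicator {..s} x * unif_min n p q (F x))"

definition marg_max :: "real \<Rightarrow> real" where
  "marg_max y = f y * (indicator {t<..} y * unif_max n p q (F y))"

lemma H_n_pos: "0 < H n p q"
  using H_pos[OF n pq] .

lemma s_le_t: "s \<le> t"
  using law.cdf_nondecreasing[of t s] F_s F_t pq by linarith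

lemma F_le_p: "x \<le> s \<Longrightarrow> F x \<le> p"
  using law.cdf_nondecreasing[of x s] F_s by simp

lemma q_le_F: "t \<le> y \<Longrightarrow> q \<le> F y"
  using law.cdf_nondecreasing[of t y] F_t by simp

lemma prob_tail: "prob {\<omega> \<in> space M. Y \<omega> \<le> s \<and> Z \<omega> > t} = H n p q"
  using prob_min_le_max_greater[OF s_le_t] F_s F_t by simp

lemma prob_space_cond: "prob_space cond"
  unfolding tail_cond_def using prob_tail H_n_pos
  by (intro prob_space_uniform_measure) (auto simp: emeasure_eq_measure)

lemma joint_nonneg: "0 \<le> joint x y"
  using unif_joint_pos[OF n pq, of "F x" "F y"] F_le_p[of x] q_le_F[of y] f_nonneg
  by (auto simp: joint_def split: split_indicator)

lemma marg_nonneg: "0 \<le> marg_min x" "0 \<le> marg_max x"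
  using unif_marginal_pos(1)[OF n pq, of "F x"] unif_marginal_pos(2)[OF n pq, of "F x"] F_le_p[of x] q_le_F[of x] f_nonneg
  by (auto simp: marg_min_def marg_max_def split: split_indicator)

lemma joint_measurable[measurable]: "(\<lambda>(x, y). joint x y) \<in> borel_measurable (borel \<Otimes>\<^sub>M borel)"
  unfolding joint_def unif_joint_def by measurable

lemma marg_measurable[measurable]: "marg_min \<in> borel_measurable borel" "marg_max \<in> borel_measurable borel"
  unfolding marg_min_def marg_max_def unif_min_def unif_max_def by measurable

lemma ennreal_joint:
  "ennreal (joint x y) = ennreal (f x) * indicator {..s} x *
    (ennreal (f y) * (ennreal (unif_joint n p q (F x) (F y)) * indicator {t<..} y))"
  using f_nonneg by (auto simp: joint_def ennreal_mult'' ennreal_mult' mult.assoc split: split_indicator)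

text \<open>The conditional law and the candidate density give the same mass to every quadrant, and
  the quadrants form an intersection-stable generator.\<close>

lemma distributed_joint:
  "distributed cond (lborel \<Otimes>\<^sub>M lborel) (\<lambda>\<omega>. (Y \<omega>, Z \<omega>)) (\<lambda>(x, y). ennreal (joint x y))"
proof -
  let ?E = "range (\<lambda>(a::real, b::real). {..a} \<times> {b<..})"
  let ?L = "distr cond (lborel \<Otimes>\<^sub>M lborel) (\<lambda>\<omega>. (Y \<omega>, Z \<omega>))"
  let ?R = "density (lborel \<Otimes>\<^sub>M lborel) (\<lambda>(x, y). ennreal (joint x y))"
  have sets_cond[measurable_cong]: "sets cond = sets M"
    by (simp add: tail_cond_def)
  have g[measurable]: "(\<lambda>(x, y). ennreal (joint x y)) \<in> borel_measurable (lborel \<Otimes>\<^sub>M lborel)"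
    using joint_measurable by (simp add: split_beta cong: measurable_cong_sets sets_pair_measure_cong)
  have YZ: "(\<lambda>\<omega>. (Y \<omega>, Z \<omega>)) \<in> measurable cond (lborel \<Otimes>\<^sub>M lborel)"
    by measurable
  \<comment> \<open>Intersecting with the conditioning event gives an event of the same type with
    thresholds \<open>min a s\<close> and \<open>max b t\<close>, still correctly ordered because
    \<open>s \<le> t\<close>.\<close>
  have L: "emeasure ?L ({..a} \<times> {b<..}) = ennreal (H n (F (min a s)) (F (max b t)) / H n p q)" for a b
  proof -
    have "emeasure ?L ({..a} \<times> {b<..}) = emeasure cond {\<omega> \<in> space M. Y \<omega> \<le> a \<and> b < Z \<omega>}"
    proof (subst emeasure_distr[OF YZ])
      have "(\<lambda>\<omega>. (Y \<omega>, Z \<omega>)) -` ({..a} \<times> {b<..}) \<inter> space cond = {\<omega> \<in> space M. Y \<omega> \<le> a \<and> b < Z \<omega>}"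
        by (auto simp: tail_cond_def)
      then show "emeasure cond ((\<lambda>\<omega>. (Y \<omega>, Z \<omega>)) -` ({..a} \<times> {b<..}) \<inter> space cond) =
          emeasure cond {\<omega> \<in> space M. Y \<omega> \<le> a \<and> b < Z \<omega>}"
        by simp
    qed auto
    also have "\<dots> = emeasure M {\<omega> \<in> space M. Y \<omega> \<le> min a s \<and> max b t < Z \<omega>} /
        emeasure M {\<omega> \<in> space M. Y \<omega> \<le> s \<and> t < Z \<omega>}"
      unfolding tail_cond_def
      by (subst emeasure_uniform_measure) (auto intro!: arg_cong2[where f = "\<lambda>A B. emeasure M A / B"])
    \<comment> \<open>That the numerator is nonnegative, as the division in \<open>ennreal\<close>
      requires, is read off from its being a probability.\<close>
    also have "\<dots> = ennreal (H n (F (min a s)) (F (max b t)) / H n p q)"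
      using s_le_t H_n_pos measure_nonneg[of M "{\<omega> \<in> space M. Y \<omega> \<le> min a s \<and> max b t < Z \<omega>}"]
      unfolding emeasure_eq_measure
      by (subst (asm) prob_min_le_max_greater, linarith, subst prob_min_le_max_greater, linarith)
        (simp add: prob_tail divide_ennreal)
    finally show ?thesis .
  qed
  have R: "emeasure ?R ({..a} \<times> {b<..}) = ennreal (H n (F (min a s)) (F (max b t)) / H n p q)" for a b
  proof -
    have "emeasure ?R ({..a} \<times> {b<..}) =
        (\<integral>\<^sup>+z. (case z of (x, y) \<Rightarrow> ennreal (joint x y)) * indicator ({..a} \<times> {b<..}) z \<partial>(lborel \<Otimes>\<^sub>M lborel))"
      by (rule emeasure_density) auto
    also have "\<dots> = (\<integral>\<^sup>+x. \<integral>\<^sup>+y. ennreal (joint x y) * indicator ({..a} \<times> {b<..}) (x, y) \<partial>lborel \<partial>lborel)"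
      by (subst lborel.nn_integral_fst[symmetric]) auto
    also have "\<dots> = (\<integral>\<^sup>+x. \<integral>\<^sup>+y. ennreal (f x) * indicator {..min a s} x *
      (ennreal (f y) * (ennreal (unif_joint n p q (F x) (F y)) * indicator {max b t<..} y)) \<partial>lborel \<partial>lborel)"
      by (intro nn_integral_cong) (auto simp: ennreal_joint split: split_indicator)
    also have "\<dots> = (\<integral>\<^sup>+x. ennreal (f x) * indicator {..min a s} x *
      (\<integral>\<^sup>+y. ennreal (f y) * (ennreal (unif_joint n p q (F x) (F y)) * indicator {max b t<..} y) \<partial>lborel) \<partial>lborel)"
      unfolding unif_joint_def by (intro nn_integral_cong nn_integral_cmult) measurable
    also have "\<dots> = ennreal (H n (F (min a s)) (F (max b t)) / H n p q)"
      using s_le_t H_n_pos by (intro nn_integral_unif_joint_rect) auto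
    finally show ?thesis .
  qed
  have "?L = ?R"
  proof (rule measure_eqI_generator_eq[where E = ?E and \<Omega> = UNIV and A = "\<lambda>k. {..real k} \<times> {- real k<..}"])
    show "Int_stable ?E"
    proof (rule Int_stableI)
      fix A B assume "A \<in> ?E" "B \<in> ?E"
      then obtain a b a' b' where "A = {..a} \<times> {b<..}" "B = {..a'} \<times> {b'<..}" by auto
      then have "A \<inter> B = {..min a a'} \<times> {max b b'<..}" by auto
      then show "A \<inter> B \<in> ?E" by auto
    qed
    show "sets ?L = sigma_sets UNIV ?E" "sets ?R = sigma_sets UNIV ?E"
      using arg_cong[OF sigma_rects, of sets] by (simp_all add: lborel_prod)
    show "(\<Union>k. {..real k} \<times> {- real k<..}) = (UNIV :: (real \<times> real) set)"
    proof (intro set_eqI iffI UNIV_I)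
      fix z :: "real \<times> real"
      obtain k where "max (fst z) (- snd z) < real k" using reals_Archimedean2 by blast
      then have "z \<in> {..real k} \<times> {- real k<..}" by (cases z) auto
      then show "z \<in> (\<Union>k. {..real k} \<times> {- real k<..})" by blast
    qed
    show "emeasure ?L ({..real k} \<times> {- real k<..}) \<noteq> \<infinity>" for k
      unfolding L by simp
  qed (auto simp: L R)
  then show ?thesis
    unfolding distributed_def using g YZ by simp
qed

lemma distributed_min: "distributed cond lborel Y (\<lambda>x. ennreal (marg_min x))"
proof -
  interpret cond: prob_space cond by (rule prob_space_cond)
  have "(\<lambda>x. \<integral>\<^sup>+y. ennreal (joint x y) \<partial>lborel) = (\<lambda>x. ennreal (marg_min x))"
  proof
    fix x
    have "(\<integral>\<^sup>+y. ennreal (joint x y) \<partial>lborel) = ennreal (f x) * indicator {..s} x *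
      (\<integral>\<^sup>+y. ennreal (f y) * (ennreal (unif_joint n p q (F x) (F y)) * indicator {t<..} y) \<partial>lborel)"
      unfolding ennreal_joint unif_joint_def by (intro nn_integral_cmult) measurable
    also have "\<dots> = ennreal (marg_min x)"
      using s_le_t H_n_pos f_nonneg F_t
      by (auto simp: nn_integral_unif_joint_right marg_min_def unif_min_def ennreal_mult'[OF f_nonneg, symmetric] split: split_indicator)
    finally show "(\<integral>\<^sup>+y. ennreal (joint x y) \<partial>lborel) = ennreal (marg_min x)" .
  qed
  then show ?thesis
    using cond.distr_marginal1[OF sigma_finite_lborel sigma_finite_lborel distributed_joint] by simp
qed

lemma distributed_max: "distributed cond lborel Z (\<lambda>y. ennreal (marg_max y))"
proof -
  interpret cond: prob_space cond by (rule prob_space_cond)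
  have "(\<lambda>y. \<integral>\<^sup>+x. ennreal (joint x y) \<partial>lborel) = (\<lambda>y. ennreal (marg_max y))"
  proof
    fix y
    have "(\<integral>\<^sup>+x. ennreal (joint x y) \<partial>lborel) = (\<integral>\<^sup>+x. ennreal (f y) * indicator {t<..} y *
      (ennreal (f x) * (ennreal (unif_joint n p q (F x) (F y)) * indicator {..s} x)) \<partial>lborel)"
      unfolding ennreal_joint by (intro nn_integral_cong) (simp add: ac_simps)
    also have "\<dots> = ennreal (f y) * indicator {t<..} y *
      (\<integral>\<^sup>+x. ennreal (f x) * (ennreal (unif_joint n p q (F x) (F y)) * indicator {..s} x) \<partial>lborel)"
      unfolding unif_joint_def by (intro nn_integral_cmult) measurable
    also have "\<dots> = ennreal (marg_max y)"
      using s_le_t H_n_pos f_nonneg F_s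
      by (auto simp: nn_integral_unif_joint_left marg_max_def unif_max_def ennreal_mult'[OF f_nonneg, symmetric] split: split_indicator)
    finally show "(\<integral>\<^sup>+x. ennreal (joint x y) \<partial>lborel) = ennreal (marg_max y)" .
  qed
  then show ?thesis
    using cond.distr_marginal2[OF sigma_finite_lborel sigma_finite_lborel distributed_joint] by simp
qed

section \<open>The mutual information as an integral over the box\<close>

lemma AE_law_iff: "(AE x in law. P x) \<longleftrightarrow> (AE x in lborel. 0 < f x \<longrightarrow> P x)"
  by (subst AE_density) auto

text \<open>The densities in the definition are determined only almost everywhere. Lifting the
  marginal identities to the plane lets all three be used at almost every point
  \<open>(x, y)\<close>.\<close>

lemma rv_density_eq:
  shows "AE z in lborel \<Otimes>\<^sub>M lborel. rv_density cond (\<lambda>\<omega>. (Y \<omega>, Z \<omega>)) z = joint (fst z) (snd z)"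
    and "AE z in lborel \<Otimes>\<^sub>M (lborel :: real measure). rv_density cond Y (fst z) = marg_min (fst z)"
    and "AE z in (lborel :: real measure) \<Otimes>\<^sub>M lborel. rv_density cond Z (snd z) = marg_max (snd z)"
proof -
  show "AE z in lborel \<Otimes>\<^sub>M lborel. rv_density cond (\<lambda>\<omega>. (Y \<omega>, Z \<omega>)) z = joint (fst z) (snd z)"
    unfolding lborel_prod
    by (rule rv_density_eq_AE) (use distributed_joint joint_nonneg in \<open>simp_all add: lborel_prod case_prod_unfold\<close>)
  have 1: "AE x in lborel. rv_density cond Y x = marg_min x"
    by (rule rv_density_eq_AE[OF distributed_min marg_nonneg(1)])
  show "AE z in lborel \<Otimes>\<^sub>M (lborel :: real measure). rv_density cond Y (fst z) = marg_min (fst z)"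
    by (rule AE_lborel_pairI(1)[OF 1])
  have 2: "AE x in lborel. rv_density cond Z x = marg_max x"
    by (rule rv_density_eq_AE[OF distributed_max marg_nonneg(2)])
  show "AE z in (lborel :: real measure) \<Otimes>\<^sub>M lborel. rv_density cond Z (snd z) = marg_max (snd z)"
    by (rule AE_lborel_pairI(2)[OF 2])
qed

text \<open>The box indicator is built in, so that the indicator of the unit square produced by the
  transform is absorbed.\<close>

definition unif_mi :: "real \<Rightarrow> real \<Rightarrow> real" where
  "unif_mi u v = indicator {0..p} u * (indicator {q..1} v *
    (unif_joint n p q u v * ln (unif_joint n p q u v / (unif_min n p q u * unif_max n p q v))))"

text \<open>Integrating against \<open>f x * f y\<close> is integrating against the product law,
  which \<open>F\<close> applied in both coordinates carries to the uniform law on the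
  square.\<close>

lemma integral_density_cdf:
  shows "integrable (lborel \<Otimes>\<^sub>M lborel) (\<lambda>(x, y). f x * f y * unif_mi (F x) (F y))"
    and "(\<integral>(x, y). f x * f y * unif_mi (F x) (F y) \<partial>(lborel \<Otimes>\<^sub>M lborel)) =
      (\<integral>(u, v). unif_mi u v \<partial>(lborel \<Otimes>\<^sub>M lborel))"
proof -
  have meas[measurable]: "(\<lambda>(u, v). unif_mi u v) \<in> borel_measurable (borel \<Otimes>\<^sub>M borel)"
    unfolding unif_mi_def unif_joint_def unif_min_def unif_max_def by measurable
  have ind: "(\<lambda>(u, v). indicator {0..1} u * indicator {0..1} v * unif_mi u v) = (\<lambda>(u, v). unif_mi u v)"
    using pq by (auto simp: unif_mi_def fun_eq_iff split: split_indicator)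
  have int: "integrable (lborel \<Otimes>\<^sub>M lborel) (\<lambda>(u, v). indicator {0..1} u * indicator {0..1} v * unif_mi u v)"
    unfolding ind unfolding unif_mi_def by (rule box_integrable[OF continuous_on_unif_mi[OF n pq]])
  have "law \<Otimes>\<^sub>M law = density (lborel \<Otimes>\<^sub>M lborel) (\<lambda>(x, y). ennreal (f x) * ennreal (f y))"
    by (intro pair_measure_density) (auto intro: sigma_finite_lborel law.sigma_finite_measure_axioms)
  then have law2: "law \<Otimes>\<^sub>M law = density (lborel \<Otimes>\<^sub>M lborel) (\<lambda>z. ennreal (f (fst z) * f (snd z)))"
    by (simp add: case_prod_unfold ennreal_mult f_nonneg)
  have meas': "(\<lambda>z. unif_mi (F (fst z)) (F (snd z))) \<in> borel_measurable (lborel \<Otimes>\<^sub>M lborel)"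
    using measurable_compose[OF _ meas, of "\<lambda>z. (F (fst z), F (snd z))"] by simp
  show "integrable (lborel \<Otimes>\<^sub>M lborel) (\<lambda>(x, y). f x * f y * unif_mi (F x) (F y))"
    using law.integral_cdf_pair(1)[OF meas int] meas' unfolding law2
    by (subst (asm) integrable_real_density) (auto simp: case_prod_unfold f_nonneg)
  have "(\<integral>(x, y). f x * f y * unif_mi (F x) (F y) \<partial>(lborel \<Otimes>\<^sub>M lborel)) =
      (\<integral>(x, y). unif_mi (F x) (F y) \<partial>(law \<Otimes>\<^sub>M law))"
    using meas' unfolding law2
    by (subst integral_real_density) (auto simp: case_prod_unfold f_nonneg)
  then show "(\<integral>(x, y). f x * f y * unif_mi (F x) (F y) \<partial>(lborel \<Otimes>\<^sub>M lborel)) =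
      (\<integral>(u, v). unif_mi u v \<partial>(lborel \<Otimes>\<^sub>M lborel))"
    unfolding law.integral_cdf_pair(2)[OF meas int] ind .
qed

text \<open>Where \<open>f x\<close> and \<open>f y\<close> are positive they cancel inside the
  logarithm, and the rectangle in \<open>(x, y)\<close> corresponds to the box in
  \<open>(F x, F y)\<close> up to null sets. Nonnegativity of the variables accounts for the lower
  limit 0 of integration.\<close>

lemma AE_integrand:
  assumes nonneg: "AE x in law. 0 \<le> x"
  shows "AE z in lborel \<Otimes>\<^sub>M lborel. indicator ({0<..<s} \<times> {t<..}) z * (case z of (x, y) \<Rightarrow> dyn_mi_integrand M Y Z s t x y) =
    (case z of (x, y) \<Rightarrow> f x * f y * unif_mi (F x) (F y))"
proof -
  have "AE x in law. x \<noteq> 0"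
    unfolding AE_law_iff using AE_lborel_singleton[of "0::real"] by eventually_elim simp
  then have "AE x in law. 0 < x \<and> x < s \<longleftrightarrow> F x \<le> p"
    using nonneg law.AE_le_iff_cdf_le[of s] law.AE_cdf_neq[of p]
    by eventually_elim (auto simp: F_s[symmetric] less_le)
  then have 1: "AE x in lborel. 0 < f x \<longrightarrow> (0 < x \<and> x < s \<longleftrightarrow> F x \<le> p)"
    unfolding AE_law_iff .
  have "AE y in law. t < y \<longleftrightarrow> q \<le> F y"
    using law.AE_le_iff_cdf_le[of t] law.AE_cdf_neq[of q]
    by eventually_elim (use F_t in auto)
  then have 2: "AE y in lborel. 0 < f y \<longrightarrow> (t < y \<longleftrightarrow> q \<le> F y)"
    unfolding AE_law_iff .
  have "AE z in lborel \<Otimes>\<^sub>M (lborel :: real measure). 0 < f (fst z) \<longrightarrow> (0 < fst z \<and> fst z < s \<longleftrightarrow> F (fst z) \<le> p)"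
    by (rule AE_lborel_pairI(1)[OF 1])
  moreover have "AE z in (lborel :: real measure) \<Otimes>\<^sub>M lborel. 0 < f (snd z) \<longrightarrow> (t < snd z \<longleftrightarrow> q \<le> F (snd z))"
    by (rule AE_lborel_pairI(2)[OF 2])
  ultimately show ?thesis
    using rv_density_eq
  proof eventually_elim
    case (elim z)
    obtain x y where z: "z = (x, y)" by (cases z)
    have F01: "0 \<le> F x" "F y \<le> 1" for x y
      using law.cdf_nonneg law.cdf_bounded_prob by auto
    have *: "dyn_mi_integrand M Y Z s t x y = joint x y * ln (joint x y / (marg_min x * marg_max y))"
      using elim(3-5) by (simp add: z dyn_mi_integrand_def)
    show ?case
    proof (cases "0 < f x \<and> 0 < f y")
      \<comment> \<open>Here \<open>joint x y = 0\<close>, so both sides vanish whatever value the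
        logarithm takes.\<close>
      case False
      then have "f x = 0 \<or> f y = 0" using f_nonneg[of x] f_nonneg[of y] by auto
      then show ?thesis by (auto simp: z * joint_def)
    next
      case True
      then have "0 < x \<and> x < s \<longleftrightarrow> F x \<le> p" "t < y \<longleftrightarrow> q \<le> F y"
        using elim(1,2) by (auto simp: z)
      then show ?thesis
        using True F01 by (auto simp: z * unif_mi_def joint_def marg_min_def marg_max_def split: split_indicator)
    qed
  qed
qed

lemma dyn_mutual_information_min_max:
  assumes nonneg: "AE x in law. 0 \<le> x"
  shows "set_integrable lborel ({0<..<s} \<times> {t<..}) (\<lambda>(x, y). dyn_mi_integrand M Y Z s t x y)"
    and "dyn_mutual_information M Y Z s t =
           ln ((real n - 1) / real n * H n p q)
           - (real n - 2) * (2 * real n - 1) / (real n * (real n - 1))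
           - real n / H n p q *
               (K n p q + K n (1 - q) (1 - p)
                + (real n - 2) / real n *
                    ((1 - p) ^ n * ln (1 - p) + q ^ n * ln q - (q - p) ^ n * ln (q - p)))"
proof -
  let ?I = "\<lambda>z. indicator ({0<..<s} \<times> {t<..}) z * (case z of (x, y) \<Rightarrow> dyn_mi_integrand M Y Z s t x y)"
  let ?U = "\<lambda>(x, y). f x * f y * unif_mi (F x) (F y)"
  have [measurable]: "rv_density cond (\<lambda>\<omega>. (Y \<omega>, Z \<omega>)) \<in> borel_measurable (borel \<Otimes>\<^sub>M borel)"
    using borel_measurable_rv_density by (simp add: borel_prod)
  have meas: "?I \<in> borel_measurable (lborel \<Otimes>\<^sub>M lborel)"
    unfolding dyn_mi_integrand_def Let_def case_prod_unfold by measurable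
  have int: "integrable (lborel \<Otimes>\<^sub>M lborel) ?I"
    using integral_density_cdf(1) by (subst integrable_cong_AE[OF meas _ AE_integrand[OF nonneg]]) auto
  then show "set_integrable lborel ({0<..<s} \<times> {t<..}) (\<lambda>(x, y). dyn_mi_integrand M Y Z s t x y)"
    by (simp add: set_integrable_def lborel_prod)
  have "dyn_mutual_information M Y Z s t = (\<integral>x. \<integral>y. ?I (x, y) \<partial>lborel \<partial>lborel)"
    by (simp add: dyn_mutual_information_def set_lebesgue_integral_def indicator_times mult.assoc)
  \<comment> \<open>Integrability over the plane justifies Fubini for the iterated integral of the
    definition.\<close>
  also have "\<dots> = integral\<^sup>L (lborel \<Otimes>\<^sub>M lborel) ?I"
    by (rule lborel_pair.integral_fst'[OF int])
  also have "\<dots> = integral\<^sup>L (lborel \<Otimes>\<^sub>M lborel) ?U"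
    using integral_density_cdf(1) by (intro integral_cong_AE meas AE_integrand[OF nonneg]) auto
  also have "\<dots> = (\<integral>(u, v). unif_mi u v \<partial>(lborel \<Otimes>\<^sub>M lborel))"
    by (rule integral_density_cdf(2))
  also note integral_unif_mi[OF n pq, folded unif_mi_def]
  finally show "dyn_mutual_information M Y Z s t =
           ln ((real n - 1) / real n * H n p q)
           - (real n - 2) * (2 * real n - 1) / (real n * (real n - 1))
           - real n / H n p q *
               (K n p q + K n (1 - q) (1 - p)
                + (real n - 2) / real n *
                    ((1 - p) ^ n * ln (1 - p) + q ^ n * ln q - (q - p) ^ n * ln (q - p)))" .
qed

end

text \<open>Integrability is asserted along with the value because the integral of a non-integrable
  function is 0 by default; the formula thus concerns a genuine integral.\<close>

theorem proposition6:
  fixes M :: "'a measure" and X :: "nat \<Rightarrow> 'a \<Rightarrow> real" and n :: nat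
    and F f :: "real \<Rightarrow> real" and p q \<xi>\<^sub>p \<xi>\<^sub>q :: real
  assumes "prob_space M"
    and "n \<ge> 2"
    and "prob_space.indep_vars M (\<lambda>_. borel) X {1..n}"
    and "\<And>x. 0 \<le> f x"
    and "\<And>i. i \<in> {1..n} \<Longrightarrow> distributed M lborel (X i) (\<lambda>x. ennreal (f x))"
    and "\<And>i. i \<in> {1..n} \<Longrightarrow> AE \<omega> in M. 0 \<le> X i \<omega>"
    and "\<And>i. i \<in> {1..n} \<Longrightarrow> cdf (distr M borel (X i)) = F"
    and "0 < p" and "p < q" and "q < 1"
    and "\<xi>\<^sub>p = generalized_inverse F p" and "\<xi>\<^sub>q = generalized_inverse F q"
  shows "set_integrable lborel ({0<..<\<xi>\<^sub>p} \<times> {\<xi>\<^sub>q<..})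
           (\<lambda>(x, y). dyn_mi_integrand M (sample_min X n) (sample_max X n) \<xi>\<^sub>p \<xi>\<^sub>q x y)
         \<and> dyn_mutual_information M (sample_min X n) (sample_max X n) \<xi>\<^sub>p \<xi>\<^sub>q =
           ln ((real n - 1) / real n * H n p q)
           - (real n - 2) * (2 * real n - 1) / (real n * (real n - 1))
           - real n / H n p q *
               (K n p q + K n (1 - q) (1 - p)
                + (real n - 2) / real n *
                    ((1 - p) ^ n * ln (1 - p) + q ^ n * ln q - (q - p) ^ n * ln (q - p)))"
proof -
  interpret iid_sample M X n f
    using assms(1-5) by (simp add: iid_sample_def iid_sample_axioms_def)
  have one: "1 \<in> {1..n}" using n by simp
  have F: "F = cdf law"
    using assms(7)[OF one] distr_X[OF one] by simp
  \<comment> \<open>\<open>generalized_inverse F\<close> unfolds to the pseudoinverse of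
    \<open>law\<close>, and continuity of \<open>F\<close> makes it attain the levels
    \<open>p\<close> and \<open>q\<close> exactly.\<close>
  have "F \<xi>\<^sub>p = p" "F \<xi>\<^sub>q = q"
    using law.cdf_quantile assms(8-12) by (simp_all add: F generalized_inverse_def)
  then interpret iid_tail_sample M X n f \<xi>\<^sub>p \<xi>\<^sub>q p q
    using assms(8-10) by unfold_locales (simp_all add: F)
  have "AE x in distr M borel (X 1). 0 \<le> x"
    using assms(6)[OF one] X_measurable[OF one] by (simp add: AE_distr_iff)
  then have "AE x in law. 0 \<le> x"
    by (simp only: distr_X[OF one])
  from dyn_mutual_information_min_max[OF this] show ?thesis by blast
qed

end
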